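(* For all $x\in\mathbb{R}\setminus\{0\}$: a) $r_x$ has exactly one extremum, located at the origin $(y,z)=(0,0)$ (corresponding to the diagonal symmetric table with the fixed odds-ratio). b) $\lim_{\|(y,z)\|\to\infty}r_x(y,z)=0$. Moreover: c) $\lim_{x\to\pm\infty}r_x(y,z)=\pm1$ for every $(y,z)\in\mathbb{R}^2$. d) $r$ (in the coordinates $(x,y,z)$) can be continuously extended to $\bar{\mathbb{R}}^3$ except for the lines $(\pm,\pm,* )$ and $(\pm,*,\pm)$ and the vertices $V$, i.e. to the complement of these sets in $\bar{\mathbb{R}}^3$. e) $r$ (as a function on $\mathbb{T}$) can be continuously extended to $\overline{\mathbb{T}}$ except for the vertices, i.e. to $\overline{\mathbb{T}}$ minus its four vertices.
   Context: $\mathbb{T}$ is the set of real $2\times2$ matrices $t=\begin{pmatrix}p_{00}&p_{01}\\ p_{10}&p_{11}\end{pmatrix}$ with all $p_{ij}>0$ and $\sum_{i,j}p_{ij}=1$; $p_{i.}=p_{i0}+p_{i1}$, $p_{.j}=p_{0j}+p_{1j}$. $\overline{\mathbb{T}}$ is its closure (all $p_{ij}\ge0$), whose four vertices are the tables with some $p_{ij}=1$. The correlation coefficient is $r=\frac{p_{00}p_{11}-p_{01}p_{10}}{\sqrt{p_{0.}p_{.0}p_{1.}p_{.1}}}$. Margin transformation coordinates on $\mathbb{T}$ are given by the diffeomorphism $\Psi:\mathbb{R}^3\to\mathbb{T}$, $\Psi(x,y,z)=\frac{1}{e^{x+y+z}+e^x+e^y+e^z}\begin{pmatrix}e^{x+y+z}&e^y\\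 e^z&e^x\end{pmatrix}$; here $x=\ln\sqrt\lambda$ with $\lambda=\frac{p_{00}p_{11}}{p_{01}p_{10}}$ the odds-ratio. In these coordinates $$r(x,y,z)=\frac{(e^{2x}-1)e^{y+z}}{\sqrt{(e^{x+y+z}+e^y)(e^{x+y+z}+e^z)(e^x+e^y)(e^x+e^z)}}.$$ For fixed $x$, $r_x(y,z)=r(x,y,z)$ (the margin weighting function). $\bar{\mathbb{R}}=\mathbb{R}\cup\{-\infty,+\infty\}$ is the two-point compactification, $\bar{\mathbb{R}}^3$ the resulting cube. In describing boundary points, $\pm$ stands for $\pm\infty$ (all sign combinations independently) and $*$ for an arbitrary finite real number; $V=\{(\pm,\pm,\pm)\}$ is the set of the eight vertices. *)

theory Defs
  imports "HOL-Analysis.Analysis"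
begin

(* The index type 2 has exactly the elements 0 and 1, so t $ i $ j is the cell p_ij with
   the usual indices i, j in {0, 1}. (The library function vector indexes by 1 and 2 = 0
   and would list the rows and columns in the opposite order.) *)
definition tables :: "(real^2^2) set" where
  "tables = {t. (\<forall>i j. 0 < t $ i $ j) \<and> (\<Sum>i\<in>UNIV. \<Sum>j\<in>UNIV. t $ i $ j) = 1}"

definition vertex_tables :: "(real^2^2) set" where
  "vertex_tables = {t \<in> closure tables. \<exists>i j. t $ i $ j = 1}"

definition row_margin :: "real^2^2 \<Rightarrow> 2 \<Rightarrow> real" where
  "row_margin t i = t $ i $ 0 + t $ i $ 1"

definition col_margin :: "real^2^2 \<Rightarrow> 2 \<Rightarrow> real" where
  "col_margin t j = t $ 0 $ j + t $ 1 $ j"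

definition odds_ratio :: "real^2^2 \<Rightarrow> real" where
  "odds_ratio t = (t $ 0 $ 0 * t $ 1 $ 1) / (t $ 0 $ 1 * t $ 1 $ 0)"

definition corr :: "real^2^2 \<Rightarrow> real" where
  "corr t = (t $ 0 $ 0 * t $ 1 $ 1 - t $ 0 $ 1 * t $ 1 $ 0) /
     sqrt (row_margin t 0 * col_margin t 0 * row_margin t 1 * col_margin t 1)"

(* Invariance under reflection in both diagonals of the table. *)
definition diagonal_symmetric :: "real^2^2 \<Rightarrow> bool" where
  "diagonal_symmetric t \<longleftrightarrow> t $ 0 $ 0 = t $ 1 $ 1 \<and> t $ 0 $ 1 = t $ 1 $ 0"

definition Psi :: "real \<times> real \<times> real \<Rightarrow> real^2^2" where
  "Psi = (\<lambda>(x, y, z). (1 / (exp (x + y + z) + exp x + exp y + exp z)) *\<^sub>R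
     (\<chi> i j. if i = 0 then (if j = 0 then exp (x + y + z) else exp y)
                      else (if j = 0 then exp z else exp x)))"

definition r_coord :: "real \<times> real \<times> real \<Rightarrow> real" where
  "r_coord p = corr (Psi p)"

definition margin_weight :: "real \<Rightarrow> real \<times> real \<Rightarrow> real" where
  "margin_weight x = (\<lambda>(y, z). r_coord (x, y, z))"

definition local_extremum_at :: "('a::topological_space \<Rightarrow> real) \<Rightarrow> 'a \<Rightarrow> bool" where
  "local_extremum_at f p \<longleftrightarrow>
     (\<forall>\<^sub>F q in nhds p. f q \<le> f p) \<or> (\<forall>\<^sub>F q in nhds p. f p \<le> f q)"

(* The two-point compactification of the real line is the type ereal with its order topology;
   the cube carries the product topology. *)
definition cube_lines :: "(ereal \<times> ereal \<times> ereal) set" where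
  "cube_lines =
     {(a, b, ereal c) | a b c. a \<in> {-\<infinity>, \<infinity>} \<and> b \<in> {-\<infinity>, \<infinity>}} \<union>
     {(a, ereal b, c) | a b c. a \<in> {-\<infinity>, \<infinity>} \<and> c \<in> {-\<infinity>, \<infinity>}}"

definition cube_vertices :: "(ereal \<times> ereal \<times> ereal) set" where
  "cube_vertices = {-\<infinity>, \<infinity>} \<times> {-\<infinity>, \<infinity>} \<times> {-\<infinity>, \<infinity>}"

lemma Psi_nth:
  fixes x y z :: real
  defines "S \<equiv> exp (x + y + z) + exp x + exp y + exp z"
  shows "Psi (x, y, z) $ 0 $ 0 = exp (x + y + z) / S" "Psi (x, y, z) $ 0 $ 1 = exp y / S"
    "Psi (x, y, z) $ 1 $ 0 = exp z / S" "Psi (x, y, z) $ 1 $ 1 = exp x / S"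
  by (simp_all add: Psi_def S_def)

lemma UNIV_2_eq: "(UNIV :: 2 set) = {0, 1}"
  using exhaust_2 by fastforce

lemma Psi_in_tables: "Psi (x, y, z) \<in> tables"
proof -
  define S where "S = exp (x + y + z) + exp x + exp y + exp z"
  have S: "S > 0" unfolding S_def by (intro add_pos_pos) auto
  have "0 < Psi (x, y, z) $ i $ j" for i j
    using S by (simp add: Psi_def S_def)
  moreover have "(\<Sum>i\<in>UNIV. \<Sum>j\<in>UNIV. Psi (x, y, z) $ i $ j) = 1"
    using S unfolding UNIV_2_eq
    by (simp add: Psi_nth S_def[symmetric] add_divide_distrib[symmetric]) (simp add: S_def)
  ultimately show ?thesis by (simp add: tables_def)
qed

lemma r_coord_eq:
  "r_coord (x, y, z) = (exp (2 * x) - 1) * exp (y + z) /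
     sqrt ((exp (x + y + z) + exp y) * (exp (x + y + z) + exp z) * (exp x + exp y) * (exp x + exp z))"
proof -
  define S where "S = exp (x + y + z) + exp x + exp y + exp z"
  have S: "S > 0" unfolding S_def by (intro add_pos_pos) auto
  have e2: "exp (2 * x) = exp x * exp x"
    by (simp add: mult_exp_exp)
  define D where "D = (exp (x + y + z) + exp y) * (exp (x + y + z) + exp z) * (exp x + exp y) * (exp x + exp z)"
  have "row_margin (Psi (x, y, z)) 0 * col_margin (Psi (x, y, z)) 0 *
      row_margin (Psi (x, y, z)) 1 * col_margin (Psi (x, y, z)) 1 = D / (S\<^sup>2)\<^sup>2"
    unfolding row_margin_def col_margin_def Psi_nth S_def[symmetric] D_def
    using S by (simp add: field_simps power2_eq_square)
  moreover have "Psi (x, y, z) $ 0 $ 0 * Psi (x, y, z) $ 1 $ 1 - Psi (x, y, z) $ 0 $ 1 * Psi (x, y, z) $ 1 $ 0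
      = (exp (2 * x) - 1) * exp (y + z) / S\<^sup>2"
    unfolding Psi_nth S_def[symmetric] e2
    using S by (simp add: field_simps power2_eq_square exp_add)
  moreover have "sqrt (D / (S\<^sup>2)\<^sup>2) = sqrt D / S\<^sup>2"
    unfolding real_sqrt_divide by (simp only: real_sqrt_abs abs_power2)
  ultimately show ?thesis
    using S unfolding r_coord_def corr_def D_def[symmetric] by simp
qed

end

(* The whole argument rests on the symmetric form
     r(x,y,z) = sinh x / sqrt ((cosh x + cosh y) (cosh x + cosh z)).
   For fixed x, abs r is strictly decreasing in cosh y and in cosh z, which gives the unique
   extremum, and r vanishes at infinity. Factoring out cosh x and writing S = 1/cosh,
     r = tanh x * sqrt (S y / (S x + S y) * (S z / (S x + S z))),
   where tanh and S extend continuously to the extended reals with S vanishing exactly at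
   the infinities; so the formula survives wherever x is finite or both y and z are, which is
   the complement of the excluded lines and vertices. On tables the determinant is at most the
   product of the row margins and at most the product of the column margins; hence corr tends
   to 0 at a boundary table with a vanishing margin that is not a vertex. *)
theory Submission
  imports Defs
begin

section \<open>Hyperbolic form and the unique extremum\<close>

lemma margin_weight_eq:
  "margin_weight x (y, z) = sinh x / sqrt ((cosh x + cosh y) * (cosh x + cosh z))"
proof -
  have S: "2 * sinh x * exp x = exp (2 * x) - 1"
    by (simp add: sinh_field_def field_simps mult_exp_exp exp_minus)
  have D: "2 * (cosh x + cosh u) * exp x * exp u = (exp (x + u) + 1) * (exp x + exp u)" for u :: real
    by (simp add: cosh_field_def field_simps exp_add exp_minus)
  \<comment> \<open>The four margins are regrouped by variable, so that each pair takes the shape of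
    \<open>D\<close> with u = y or u = z. All exponentials then combine into a perfect square that
    leaves the root.\<close>
  have "(exp (x + y + z) + exp y) * (exp (x + y + z) + exp z) * (exp x + exp y) * (exp x + exp z)
      = exp (y + z) * ((exp (x + y) + 1) * (exp x + exp y)) * ((exp (x + z) + 1) * (exp x + exp z))"
    by (simp add: exp_add algebra_simps)
  also have "\<dots> = (cosh x + cosh y) * (cosh x + cosh z) * (2 * exp x * exp (y + z))\<^sup>2"
    unfolding D[symmetric] by (simp add: exp_add power2_eq_square algebra_simps)
  finally have "sqrt ((exp (x + y + z) + exp y) * (exp (x + y + z) + exp z) * (exp x + exp y) * (exp x + exp z))
      = sqrt ((cosh x + cosh y) * (cosh x + cosh z)) * (2 * exp x * exp (y + z))"
    by (simp add: real_sqrt_mult abs_mult)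
  then show ?thesis
    unfolding margin_weight_def r_coord_eq S[symmetric] by simp
qed

lemma margin_weight_swap: "margin_weight x (y, z) = margin_weight x (z, y)"
  by (simp add: margin_weight_eq mult.commute)

text \<open>With z fixed, the positive denominator is increasing in \<open>cosh y\<close>, and the
  sign of \<open>sinh x\<close> decides the direction. As an equivalence it also transfers local
  extrema to \<open>cosh\<close>.\<close>

lemma margin_weight_le_iff:
  assumes "x \<noteq> 0"
  shows "margin_weight x (y, z) \<le> margin_weight x (y', z) \<longleftrightarrow>
    (if x > 0 then cosh y' \<le> cosh y else cosh y \<le> cosh y')"
proof -
  define k where "k u = sqrt ((cosh x + cosh u) * (cosh x + cosh z))" for u
  have pos: "k u > 0" for u
    unfolding k_def by (simp add: add_pos_pos)
  have le: "k u \<le> k v \<longleftrightarrow> cosh u \<le> cosh v" for u v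
    unfolding k_def by (simp add: add_pos_pos)
  have "margin_weight x (y, z) \<le> margin_weight x (y', z) \<longleftrightarrow> sinh x * k y' \<le> sinh x * k y"
    using pos[of y] pos[of y'] unfolding margin_weight_eq k_def[symmetric] by (simp add: field_simps)
  then show ?thesis
    using assms by (auto simp: mult_le_cancel_left le)
qed

text \<open>One coordinate is changed at a time, passing through \<open>(y', z)\<close>; symmetry in
  y and z reduces the second move to the first.\<close>

lemma margin_weight_antimono_cosh:
  assumes "x \<noteq> 0" "cosh y \<le> cosh y'" "cosh z \<le> cosh z'"
  shows "if x > 0 then margin_weight x (y', z') \<le> margin_weight x (y, z)
    else margin_weight x (y, z) \<le> margin_weight x (y', z')"
  using margin_weight_le_iff[OF assms(1), of y z y'] margin_weight_le_iff[OF assms(1), of y' z y]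
    margin_weight_le_iff[OF assms(1), of z y' z'] margin_weight_le_iff[OF assms(1), of z' y' z]
    margin_weight_swap[of x y' z] margin_weight_swap[of x y' z'] assms
  by (auto split: if_splits)

lemma cosh_local_extremum_imp_zero:
  fixes y :: real
  assumes "local_extremum_at cosh y"
  shows "y = 0"
proof -
  have d: "(cosh has_real_derivative sinh y) (at y)"
    by (auto intro!: derivative_eq_intros)
  have "sinh y = 0"
    using assms unfolding local_extremum_at_def
  proof
    assume "\<forall>\<^sub>F t in nhds y. cosh t \<le> cosh y"
    then obtain e where "e > 0" "\<And>t. dist t y < e \<Longrightarrow> cosh t \<le> cosh y"
      unfolding eventually_nhds_metric by blast
    then show ?thesis
      using DERIV_local_max[OF d, of e] by (auto simp: dist_real_def abs_minus_commute)
  next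
    assume "\<forall>\<^sub>F t in nhds y. cosh y \<le> cosh t"
    then obtain e where "e > 0" "\<And>t. dist t y < e \<Longrightarrow> cosh y \<le> cosh t"
      unfolding eventually_nhds_metric by blast
    then show ?thesis
      using DERIV_local_min[OF d, of e] by (auto simp: dist_real_def abs_minus_commute)
  qed
  then show ?thesis by simp
qed

text \<open>Continuity pulls a neighbourhood of \<open>g t\<close> back to one of \<open>t\<close>.
  With \<open>g\<close> a coordinate line, this reduces an extremum in the plane to one
  variable.\<close>

lemma local_extremum_at_compose:
  assumes "local_extremum_at f (g t)" "isCont g t"
  shows "local_extremum_at (f \<circ> g) t"
proof -
  have "filterlim g (nhds (g t)) (nhds t)"
    using assms(2) by (simp add: continuous_at tendsto_at_iff_tendsto_nhds)
  then show ?thesis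
    using assms(1) unfolding local_extremum_at_def filterlim_iff by auto
qed

lemma margin_weight_local_extremum_fst:
  assumes "x \<noteq> 0" "local_extremum_at (margin_weight x \<circ> (\<lambda>t. (t, z))) y"
  shows "y = 0"
proof (rule cosh_local_extremum_imp_zero)
  show "local_extremum_at cosh y"
    \<comment> \<open>For positive x the order reverses: a maximum of the weight is a minimum of
      \<open>cosh\<close>. For negative x the order is kept.\<close>
    using assms by (cases "x > 0") (auto simp: local_extremum_at_def margin_weight_le_iff)
qed

lemma margin_weight_local_extrema:
  assumes "x \<noteq> 0"
  shows "{p. local_extremum_at (margin_weight x) p} = {(0, 0)}"
proof (intro equalityI subsetI)
  fix p assume "p \<in> {p. local_extremum_at (margin_weight x) p}"
  then obtain y z where p: "p = (y, z)" and ext: "local_extremum_at (margin_weight x) (y, z)"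
    by (cases p) auto
  have "local_extremum_at (margin_weight x \<circ> (\<lambda>t. (t, z))) y"
    by (rule local_extremum_at_compose) (use ext in \<open>auto intro!: continuous_intros\<close>)
  moreover have "local_extremum_at (margin_weight x \<circ> (\<lambda>t. (y, t))) z"
    by (rule local_extremum_at_compose) (use ext in \<open>auto intro!: continuous_intros\<close>)
  moreover have "margin_weight x \<circ> (\<lambda>t. (y, t)) = margin_weight x \<circ> (\<lambda>t. (t, y))"
    by (auto simp: fun_eq_iff margin_weight_swap)
  ultimately show "p \<in> {(0, 0)}"
    using margin_weight_local_extremum_fst[OF assms] p by auto
next
  fix p :: "real \<times> real" assume "p \<in> {(0, 0)}"
  \<comment> \<open>Since \<open>cosh\<close> is least at 0, the origin is even a global extremum: a
    maximum for positive x, a minimum for negative x.\<close>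
  moreover have "if x > 0 then margin_weight x q \<le> margin_weight x (0, 0)
    else margin_weight x (0, 0) \<le> margin_weight x q" for q
    using margin_weight_antimono_cosh[OF assms, of 0 "fst q" 0 "snd q"]
    unfolding prod.collapse by (simp add: cosh_real_ge_1)
  ultimately show "p \<in> {p. local_extremum_at (margin_weight x) p}"
    by (cases "x > 0") (auto simp: local_extremum_at_def)
qed

section \<open>Decay at infinity\<close>

lemma margin_weight_at_infinity: "(margin_weight x \<longlongrightarrow> 0) at_infinity"
proof (rule Lim_null_comparison)
  have cosh_ge: "\<bar>u\<bar> / 2 \<le> cosh u" for u :: real
  proof -
    have "\<bar>u\<bar> \<le> exp \<bar>u\<bar>"
      using exp_ge_add_one_self[of "\<bar>u\<bar>"] by linarith
    also have "\<dots> \<le> exp u + exp (- u)"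
      by (cases "u \<ge> 0") auto
    finally show ?thesis by (simp add: cosh_field_def)
  qed
  \<comment> \<open>The origin must be kept out: there the right side is 0 by division by
    zero.\<close>
  have "norm (margin_weight x p) \<le> \<bar>sinh x\<bar> / sqrt (norm p / 2)" if "norm p \<ge> 1" for p
  proof -
    obtain y z where p: "p = (y, z)" by (cases p)
    have "norm p / 2 \<le> \<bar>y\<bar> / 2 + \<bar>z\<bar> / 2"
      using norm_Pair_le[of y z] p by simp
    \<comment> \<open>Because \<open>cosh x\<close> is at least 1, it can be multiplied in; the
      result is the two mixed terms of the product under the root.\<close>
    also have "\<dots> \<le> cosh x * cosh z + cosh x * cosh y"
      using cosh_ge[of y] cosh_ge[of z] mult_right_mono[OF cosh_real_ge_1[of x], of "cosh y"]
        mult_right_mono[OF cosh_real_ge_1[of x], of "cosh z"] cosh_real_nonneg[of y] cosh_real_nonneg[of z]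
      by linarith
    also have "\<dots> \<le> (cosh x + cosh y) * (cosh x + cosh z)"
      by (simp add: algebra_simps)
    finally have "sqrt (norm p / 2) \<le> sqrt ((cosh x + cosh y) * (cosh x + cosh z))"
      by simp
    moreover have "sqrt (norm p / 2) > 0"
      using that by (intro real_sqrt_gt_zero) linarith
    ultimately show ?thesis
      unfolding p margin_weight_eq by (simp add: abs_mult add_pos_pos frac_le)
  qed
  then show "\<forall>\<^sub>F p in at_infinity. norm (margin_weight x p) \<le> \<bar>sinh x\<bar> / sqrt (norm p / 2)"
    unfolding eventually_at_infinity by blast
  have "filterlim (\<lambda>p::real \<times> real. sqrt (norm p / 2)) at_top at_infinity"
    unfolding divide_inverse
    by (intro filterlim_compose[OF sqrt_at_top] filterlim_at_top_mult_tendsto_pos[OF tendsto_const]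
        filterlim_norm_at_top) simp
  then show "((\<lambda>p. \<bar>sinh x\<bar> / sqrt (norm p / 2)) \<longlongrightarrow> 0) (at_infinity :: (real \<times> real) filter)"
    by (rule real_tendsto_divide_at_top[OF tendsto_const])
qed

section \<open>Diagonal symmetric tables of given odds-ratio\<close>

lemma forall_2_iff: "(\<forall>i::2. P i) \<longleftrightarrow> P 0 \<and> P 1"
  using UNIV_2_eq by (metis UNIV_I insert_iff singletonD)

text \<open>Such a table has only two distinct cells a and b, with odds-ratio (a/b)^2. Hence x fixes
  the ratio a/b, and total mass 1 fixes the scale.\<close>

lemma diagonal_symmetric_tables_odds_ratio:
  "{t \<in> tables. diagonal_symmetric t \<and> ln (sqrt (odds_ratio t)) = x} = {Psi (x, 0, 0)}"
proof (intro equalityI subsetI)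
  fix t assume "t \<in> {t \<in> tables. diagonal_symmetric t \<and> ln (sqrt (odds_ratio t)) = x}"
  then have t: "t \<in> tables" "t $ 1 $ 1 = t $ 0 $ 0" "t $ 1 $ 0 = t $ 0 $ 1"
      "ln (sqrt (odds_ratio t)) = x"
    by (auto simp: diagonal_symmetric_def)
  define a b where "a = t $ 0 $ 0" and "b = t $ 0 $ 1"
  have ab: "a > 0" "b > 0" "2 * a + 2 * b = 1"
    using t by (auto simp: tables_def UNIV_2_eq a_def b_def)
  have "odds_ratio t = (a / b)\<^sup>2"
    using t by (simp add: odds_ratio_def a_def b_def power2_eq_square)
  then have "a / b = exp x"
    using t(4) ab by (auto simp: exp_ln)
  then have a: "a = exp x * b"
    using ab by (simp add: field_simps)
  \<comment> \<open>The denominator stays unsimplified to match the normalising sum of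
    \<open>Psi (x, 0, 0)\<close> term by term.\<close>
  have b: "b = 1 / (exp x + exp x + 1 + 1)"
  proof (rule eq_divide_imp)
    show "exp x + exp x + 1 + 1 \<noteq> 0"
      by (smt (verit) exp_gt_zero)
    show "b * (exp x + exp x + 1 + 1) = 1"
      using ab(3) a by (simp add: algebra_simps)
  qed
  have "t = Psi (x, 0, 0)"
    unfolding vec_eq_iff forall_2_iff Psi_nth
    using t(2,3) a b by (simp add: a_def[symmetric] b_def[symmetric])
  then show "t \<in> {Psi (x, 0, 0)}" by simp
next
  fix t assume "t \<in> {Psi (x, 0, 0)}"
  then have t: "t = Psi (x, 0, 0)" by simp
  have "(exp x / s) * (exp x / s) / ((1 / s) * (1 / s)) = (exp x)\<^sup>2" if "s > 0" for s
    using that by (simp add: power2_eq_square)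
  from this[of "exp x + exp x + 1 + 1"] have "odds_ratio t = (exp x)\<^sup>2"
    unfolding t odds_ratio_def Psi_nth by (simp add: add_pos_pos)
  then show "t \<in> {t \<in> tables. diagonal_symmetric t \<and> ln (sqrt (odds_ratio t)) = x}"
    unfolding t by (simp add: Psi_in_tables diagonal_symmetric_def Psi_nth)
qed

section \<open>Limits in x\<close>

definition sech :: "real \<Rightarrow> real" where
  "sech x = inverse (cosh x)"

lemma sech_pos [simp]: "sech x > 0"
  by (simp add: sech_def)

lemma sech_nonzero [simp]: "sech x \<noteq> 0"
  by (simp add: sech_def)

lemma sech_at_top: "(sech \<longlongrightarrow> 0) at_top"
  unfolding sech_def by (rule tendsto_inverse_0_at_top[OF cosh_real_at_top])

lemma sech_at_bot: "(sech \<longlongrightarrow> 0) at_bot"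
  unfolding sech_def by (rule tendsto_inverse_0_at_top[OF cosh_real_at_bot])

lemma margin_weight_eq_tanh_sech:
  "margin_weight x (y, z) =
    tanh x * sqrt (sech y / (sech x + sech y) * (sech z / (sech x + sech z)))"
proof -
  have w: "sech u / (sech x + sech u) = cosh x / (cosh x + cosh u)" for u
    by (simp add: sech_def field_simps add_pos_pos)
  have "sqrt (sech y / (sech x + sech y) * (sech z / (sech x + sech z)))
      = cosh x / sqrt ((cosh x + cosh y) * (cosh x + cosh z))"
    unfolding w by (simp add: real_sqrt_divide real_sqrt_mult)
  then show ?thesis
    by (simp add: margin_weight_eq tanh_def)
qed

text \<open>As \<open>sech x\<close> tends to 0, both fractions under the root tend to 1, since
  \<open>sech y\<close> and \<open>sech z\<close> are nonzero; only \<open>tanh x\<close> remains.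
  The filter is arbitrary so that both ends are covered.\<close>

lemma tendsto_margin_weight:
  assumes "(sech \<longlongrightarrow> 0) F" "(tanh \<longlongrightarrow> l) F"
  shows "((\<lambda>x. margin_weight x (y, z)) \<longlongrightarrow> l) F"
proof -
  have "((\<lambda>x. margin_weight x (y, z)) \<longlongrightarrow>
      l * sqrt (sech y / (0 + sech y) * (sech z / (0 + sech z)))) F"
    unfolding margin_weight_eq_tanh_sech 
    by (intro tendsto_intros assms) auto
  then show ?thesis
    by simp
qed

section \<open>Continuous extension to the cube\<close>

definition extend_ereal :: "(real \<Rightarrow> 'a) \<Rightarrow> 'a \<Rightarrow> 'a \<Rightarrow> ereal \<Rightarrow> 'a" where
  "extend_ereal f m p x = (if x = \<infinity> then p else if x = -\<infinity> then m else f (real_of_ereal x))"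

lemma extend_ereal_simps [simp]:
  "extend_ereal f m p (ereal x) = f x" "extend_ereal f m p \<infinity> = p" "extend_ereal f m p (-\<infinity>) = m"
  by (simp_all add: extend_ereal_def)

text \<open>The punctured neighbourhood filter of each extended real is the image under
  \<open>ereal\<close> of a filter on the reals: \<open>at r\<close> at a finite point,
  \<open>at_top\<close> and \<open>at_bot\<close> at the infinities, where only one side is
  nontrivial.\<close>

lemma continuous_on_extend_ereal:
  fixes f :: "real \<Rightarrow> 'a :: topological_space"
  assumes "continuous_on UNIV f" "(f \<longlongrightarrow> m) at_bot" "(f \<longlongrightarrow> p) at_top"
  shows "continuous_on A (extend_ereal f m p)"
proof -
  let ?g = "extend_ereal f m p"
  have "isCont ?g x" for x
  proof (cases x)
    case (real r)
    have "(f \<longlongrightarrow> f r) (at r)"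
      using assms(1) by (simp add: continuous_on_def)
    then show ?thesis
      unfolding real isCont_def unfolding at_ereal by (simp add: filterlim_filtermap)
  next
    case PInf
    have "at_right (\<infinity>::ereal) = bot"
      by (simp add: at_within_def greaterThan_def)
    then show ?thesis
      using assms(3) unfolding PInf isCont_def unfolding at_eq_sup_left_right
      by (simp add: filterlim_sup at_left_PInf filterlim_filtermap)
  next
    case MInf
    have "at_left (-\<infinity>::ereal) = bot"
      by (simp add: at_within_def lessThan_def)
    then show ?thesis
      using assms(2) unfolding MInf isCont_def unfolding at_eq_sup_left_right
      by (simp add: filterlim_sup at_right_MInf filterlim_filtermap)
  qed
  then show ?thesis
    by (rule continuous_at_imp_continuous_on[OF ballI])
qed

lemma r_coord_extends_to_cube:
  "\<exists>R :: ereal \<times> ereal \<times> ereal \<Rightarrow> real.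
    continuous_on (UNIV - (cube_lines \<union> cube_vertices)) R \<and>
    (\<forall>x y z::real. R (ereal x, ereal y, ereal z) = r_coord (x, y, z))"
proof -
  define T where "T = extend_ereal tanh (-1::real) 1"
  define S where "S = extend_ereal sech 0 0"
  define R where "R = (\<lambda>(a, b, c). T a * sqrt (S b / (S a + S b) * (S c / (S a + S c))))"
  have T: "continuous_on A T" for A
    unfolding T_def
    by (rule continuous_on_extend_ereal)
      (auto intro!: continuous_intros tanh_real_at_top tanh_real_at_bot)
  have S: "continuous_on A S" for A
    unfolding S_def sech_def[abs_def]
    by (rule continuous_on_extend_ereal)
      (use sech_at_top sech_at_bot in \<open>auto intro!: continuous_intros simp: sech_def[abs_def]\<close>)
  have S_ge: "S a \<ge> 0" and S_zero: "S a = 0 \<longleftrightarrow> a \<in> {-\<infinity>, \<infinity>}" for a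
    by (cases a; simp add: S_def less_imp_le)+
  \<comment> \<open>By nonnegativity a denominator vanishes only if both summands do, that is, if a
    and one of b, c are infinite. These are exactly the removed points.\<close>
  have S_sum: "S a + S b \<noteq> 0 \<and> S a + S c \<noteq> 0"
    if "(a, b, c) \<in> UNIV - (cube_lines \<union> cube_vertices)" for a b c
    using that S_ge[of a] S_ge[of b] S_ge[of c] S_zero
    by (cases a; cases b; cases c) (auto simp: cube_lines_def cube_vertices_def add_nonneg_eq_0_iff)
  have S_comp: "continuous_on A (\<lambda>p. S (h p))" and T_comp: "continuous_on A (\<lambda>p. T (h p))"
    if "continuous_on A h" for A :: "(ereal \<times> ereal \<times> ereal) set" and h
    using continuous_on_compose2[OF S that subset_UNIV] continuous_on_compose2[OF T that subset_UNIV]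
    by auto
  have "continuous_on (UNIV - (cube_lines \<union> cube_vertices)) R"
    unfolding R_def case_prod_beta
    using S_sum by (intro continuous_intros S_comp T_comp) auto
  moreover have "R (ereal x, ereal y, ereal z) = r_coord (x, y, z)" for x y z
    using margin_weight_eq_tanh_sech[of x y z] by (simp add: R_def T_def S_def margin_weight_def)
  ultimately show ?thesis by blast
qed

section \<open>Continuous extension to the closed simplex of tables\<close>

lemma closure_tables_subset:
  "closure tables \<subseteq> {t. (\<forall>i j. 0 \<le> t $ i $ j) \<and> (\<Sum>i\<in>UNIV. \<Sum>j\<in>UNIV. t $ i $ j) = 1}"
proof (rule closure_minimal)
  show "closed {t :: real^2^2. (\<forall>i j. 0 \<le> t $ i $ j) \<and> (\<Sum>i\<in>UNIV. \<Sum>j\<in>UNIV. t $ i $ j) = 1}"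
    by (intro closed_Collect_conj closed_Collect_all closed_Collect_le closed_Collect_eq continuous_intros)
qed (auto simp: tables_def intro: less_imp_le)

text \<open>Both products in the determinant occur in the expansion of the row product P and of the
  column product Q. The first bound serves where P vanishes, the second where Q does.\<close>

lemma abs_corr_le:
  assumes "\<And>i j. 0 \<le> t $ i $ j"
  shows "\<bar>corr t\<bar> \<le> sqrt ((row_margin t 0 * row_margin t 1) / (col_margin t 0 * col_margin t 1))"
    and "\<bar>corr t\<bar> \<le> sqrt ((col_margin t 0 * col_margin t 1) / (row_margin t 0 * row_margin t 1))"
proof -
  define N where "N = \<bar>t $ 0 $ 0 * t $ 1 $ 1 - t $ 0 $ 1 * t $ 1 $ 0\<bar>"
  define P where "P = row_margin t 0 * row_margin t 1"
  define Q where "Q = col_margin t 0 * col_margin t 1"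
  have nonneg: "0 \<le> t $ i $ j * t $ k $ l" for i j k l
    using assms by simp
  have NPQ: "0 \<le> N" "N \<le> P" "N \<le> Q"
    using nonneg[of 0 0 1 1] nonneg[of 0 1 1 0] nonneg[of 0 0 1 0] nonneg[of 0 1 1 1]
      nonneg[of 0 0 0 1] nonneg[of 1 0 1 1]
    unfolding N_def P_def Q_def row_margin_def col_margin_def
    by (simp_all add: algebra_simps abs_le_iff)
  have "row_margin t 0 * col_margin t 0 * row_margin t 1 * col_margin t 1 = P * Q"
    by (simp add: P_def Q_def)
  then have corr: "\<bar>corr t\<bar> = N / sqrt (P * Q)"
    using NPQ by (simp add: corr_def N_def)
  have bound: "n / sqrt (p * q) \<le> sqrt (p / q)" if "n \<le> p" "0 \<le> n" "0 \<le> q" for n p q :: real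
  \<comment> \<open>If p or q is 0, both sides are 0 by the convention x / 0 = 0.\<close>
  proof (cases "p = 0 \<or> q = 0")
    case False
    then have "n / sqrt (p * q) \<le> p / (sqrt p * sqrt q)"
      using that by (simp add: real_sqrt_mult divide_right_mono)
    also have "\<dots> = sqrt (p / q)"
      using that False by (simp add: real_sqrt_divide real_div_sqrt flip: divide_divide_eq_left)
    finally show ?thesis .
  qed auto
  show "\<bar>corr t\<bar> \<le> sqrt (P / Q)" "\<bar>corr t\<bar> \<le> sqrt (Q / P)"
    using bound[of N P Q] bound[of N Q P] NPQ unfolding corr by (simp_all add: mult.commute)
qed

(* At a table with a vanishing margin, corr itself has the limiting value 0, by x / 0 = 0. *)
lemma continuous_on_corr: "continuous_on (closure tables - vertex_tables) corr"
  unfolding continuous_on_def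
proof
  fix t assume t: "t \<in> closure tables - vertex_tables"
  let ?F = "at t within (closure tables - vertex_tables)"
  define P where "P s = row_margin s 0 * row_margin s 1" for s
  define Q where "Q s = col_margin s 0 * col_margin s 1" for s
  have ge: "0 \<le> s $ i $ j" if "s \<in> closure tables" for s i j
    using that closure_tables_subset by blast
  have sum: "t $ 0 $ 0 + t $ 0 $ 1 + (t $ 1 $ 0 + t $ 1 $ 1) = 1"
    using t closure_tables_subset by (auto simp: UNIV_2_eq)
  have ne1: "t $ i $ j \<noteq> 1" for i j
    using t by (auto simp: vertex_tables_def)
  have lim: "(P \<longlongrightarrow> P t) ?F" "(Q \<longlongrightarrow> Q t) ?F"
    unfolding P_def Q_def row_margin_def col_margin_def by (intro tendsto_intros)+
  have bounds: "\<forall>\<^sub>F s in ?F. norm (corr s) \<le> sqrt (P s / Q s)" "\<forall>\<^sub>F s in ?F. norm (corr s) \<le> sqrt (Q s / P s)"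
    using abs_corr_le ge unfolding P_def Q_def eventually_at_filter by (auto intro!: always_eventually)
  \<comment> \<open>If both products vanish, a row and a column are zero, so the one remaining cell
    carries mass 1 and t is a vertex.\<close>
  have not_both: "P t \<noteq> 0 \<or> Q t \<noteq> 0"
  proof (rule ccontr)
    assume "\<not> (P t \<noteq> 0 \<or> Q t \<noteq> 0)"
    then have "(row_margin t 0 = 0 \<or> row_margin t 1 = 0) \<and> (col_margin t 0 = 0 \<or> col_margin t 1 = 0)"
      by (simp add: P_def Q_def)
    moreover have "0 \<le> t $ i $ j" for i j
      using ge t by blast
    ultimately show False
      using sum ne1 unfolding row_margin_def col_margin_def
      by (auto simp: add_nonneg_eq_0_iff)
  qed
  show "(corr \<longlongrightarrow> corr t) ?F"
  proof (cases "P t = 0 \<or> Q t = 0")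
    case True
    then have "corr t = 0"
      by (auto simp: corr_def P_def Q_def)
    moreover have "(corr \<longlongrightarrow> 0) ?F"
    proof (cases "P t = 0")
      case True
      \<comment> \<open>Here \<open>Q t\<close> is nonzero by \<open>not_both\<close>, so the bound
        is continuous at t and its limit is 0.\<close>
      then have "((\<lambda>s. sqrt (P s / Q s)) \<longlongrightarrow> sqrt (0 / Q t)) ?F"
        using not_both lim by (intro tendsto_intros) auto
      then show ?thesis
        by (intro Lim_null_comparison[OF bounds(1)]) simp
    next
      case False
      then have "((\<lambda>s. sqrt (Q s / P s)) \<longlongrightarrow> sqrt (0 / P t)) ?F"
        using True lim by (intro tendsto_intros) auto
      then show ?thesis
        by (intro Lim_null_comparison[OF bounds(2)]) simp
    qed
    ultimately show ?thesis by simp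
  next
    case False
    then show ?thesis
      unfolding corr_def P_def Q_def row_margin_def col_margin_def
      by (intro tendsto_intros) auto
  qed
qed

theorem proposition6:
  shows
    "(\<forall>x::real. x \<noteq> 0 \<longrightarrow>
        {p. local_extremum_at (margin_weight x) p} = {(0, 0)} \<and>
        {t \<in> tables. diagonal_symmetric t \<and> ln (sqrt (odds_ratio t)) = x} = {Psi (x, 0, 0)} \<and>
        (margin_weight x \<longlongrightarrow> 0) at_infinity)
     \<and> (\<forall>y z::real.
          ((\<lambda>x. margin_weight x (y, z)) \<longlongrightarrow> 1) at_top \<and>
          ((\<lambda>x. margin_weight x (y, z)) \<longlongrightarrow> -1) at_bot)
     \<and> (\<exists>R :: ereal \<times> ereal \<times> ereal \<Rightarrow> real.
          continuous_on (UNIV - (cube_lines \<union> cube_vertices)) R \<and>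
          (\<forall>x y z::real. R (ereal x, ereal y, ereal z) = r_coord (x, y, z)))
     \<and> (\<exists>R :: real^2^2 \<Rightarrow> real.
          continuous_on (closure tables - vertex_tables) R \<and>
          (\<forall>t \<in> tables. R t = corr t))"
proof (intro conjI allI impI)
  show "\<exists>R :: real^2^2 \<Rightarrow> real. continuous_on (closure tables - vertex_tables) R \<and>
      (\<forall>t \<in> tables. R t = corr t)"
    using continuous_on_corr by blast
qed (rule margin_weight_local_extrema diagonal_symmetric_tables_odds_ratio
      margin_weight_at_infinity r_coord_extends_to_cube
      tendsto_margin_weight[OF sech_at_top tanh_real_at_top]
      tendsto_margin_weight[OF sech_at_bot tanh_real_at_bot] | assumption)+

end
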